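(* Let $(\mathfrak g,\varphi,\xi,\eta,g)$ be an almost contact metric Lie algebra with abelian structure, and let $\alpha\in\mathbb R$. Then $(\varphi,\xi,\eta,g)$ is an $\alpha$-coK\"ahler structure if and only if 1. $\mathfrak h=\operatorname{Ker}\eta$ is a subalgebra of $\mathfrak g$ endowed with an abelian K\"ahler structure (given by $J=\varphi|_{\mathfrak h}$ and the restriction of $g$); 2. the symmetric part of the derivation $\mathrm{ad}_\xi:\mathfrak h\to\mathfrak h$ coincides with $-\alpha I$.
   Context: An almost contact metric Lie algebra is a real Lie algebra $\mathfrak g$ of dimension $2n+1$ with $\varphi\in\mathrm{End}(\mathfrak g)$, $\xi\in\mathfrak g$, $\eta\in\mathfrak g^*$ and an inner product $g$ such that $\varphi^2=-I+\eta\otimes\xi$, $\eta(\xi)=1$ and $g(\varphi X,\varphi Y)=g(X,Y)-\eta(X)\eta(Y)$. Its fundamental $2$-form is $\Phi(X,Y)=g(X,\varphi Y)$. The structure is abelian if $\mathrm{ad}_\xi\circ\varphi=\varphi\circ\mathrm{ad}_\xi$ and $[\varphi X,\varphi Y]=[X,Y]$ for all $X,Y\in\operatorname{Ker}\eta$; this implies that it is normal, i.e. $N_\varphi=[\varphi,\varphi]+d\eta\otimes\xi=0$ with $[\varphi,\varphi](X,Y)=[\varphi X,\varphi Y]+\varphi^2[X,Y]-\varphi[\varphi X,Y]-\varphi[X,\varphi Y]$, and that $\mathrm{ad}_\xi$ preserves $\operatorname{Ker}\eta$. For $\alpha\in\mathbb R$, a normal almost contact metric structure is $\alpha$-coK\"ahler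 if $d\eta=0$ and $d\Phi=2\alpha\,\eta\wedge\Phi$. An abelian K\"ahler structure on a Lie algebra $\mathfrak h$ is a pair $(J,g)$ where $J^2=-I$, $[JX,JY]=[X,Y]$ for all $X,Y$, $g$ is an inner product with $g(JX,JY)=g(X,Y)$, and the $2$-form $\Omega=g(\cdot,J\cdot)$ is closed. The symmetric part of an endomorphism $D$ of $(\mathfrak h,g)$ is $\frac12(D+D^* )$. Conventions: $d\eta(X,Y)=-\eta([X,Y])$; $d\Phi(X,Y,Z)=-\Phi([X,Y],Z)-\Phi([Y,Z],X)-\Phi([Z,X],Y)$; $(\eta\wedge\Phi)(X,Y,Z)=\eta(X)\Phi(Y,Z)+\eta(Y)\Phi(Z,X)+\eta(Z)\Phi(X,Y)$. *)

theory Defs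
  imports Complex_Main
begin

section \<open>Linear algebra on a subspace\<close>

text \<open>The notions below are relative to a carrier \<open>V\<close>, so that a subspace with the restricted
  operations is treated like the whole space, which is the case \<open>V = UNIV\<close>.\<close>

definition linear_on :: "'a::real_vector set \<Rightarrow> ('a \<Rightarrow> 'b::real_vector) \<Rightarrow> bool" where
  "linear_on V f \<longleftrightarrow> (\<forall>x\<in>V. \<forall>y\<in>V. f (x + y) = f x + f y) \<and>
                   (\<forall>c. \<forall>x\<in>V. f (c *\<^sub>R x) = c *\<^sub>R f x)"

definition endomorphism_on :: "'a::real_vector set \<Rightarrow> ('a \<Rightarrow> 'a) \<Rightarrow> bool" where
  "endomorphism_on V f \<longleftrightarrow> linear_on V f \<and> (\<forall>x\<in>V. f x \<in> V)"

definition bilinear_on :: "'a::real_vector set \<Rightarrow> ('a \<Rightarrow> 'a \<Rightarrow> 'b::real_vector) \<Rightarrow> bool" where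
  "bilinear_on V b \<longleftrightarrow> (\<forall>x\<in>V. linear_on V (\<lambda>y. b x y)) \<and> (\<forall>y\<in>V. linear_on V (\<lambda>x. b x y))"

definition inner_product_on :: "'a::real_vector set \<Rightarrow> ('a \<Rightarrow> 'a \<Rightarrow> real) \<Rightarrow> bool" where
  "inner_product_on V g \<longleftrightarrow> bilinear_on V g \<and> (\<forall>x\<in>V. \<forall>y\<in>V. g x y = g y x) \<and>
                          (\<forall>x\<in>V. x \<noteq> 0 \<longrightarrow> g x x > 0)"

text \<open>The adjoint is determined only on \<open>V\<close>; for finite-dimensional \<open>V\<close> see \<open>adjoint_on\<close> and
  \<open>adjoint_on_unique\<close> below.\<close>

definition adjoint_on :: "'a::real_vector set \<Rightarrow> ('a \<Rightarrow> 'a \<Rightarrow> real) \<Rightarrow> ('a \<Rightarrow> 'a) \<Rightarrow> 'a \<Rightarrow> 'a" where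
  "adjoint_on V g D =
     (SOME D'. endomorphism_on V D' \<and> (\<forall>x\<in>V. \<forall>y\<in>V. g (D x) y = g x (D' y)))"

definition symmetric_part_on ::
    "'a::real_vector set \<Rightarrow> ('a \<Rightarrow> 'a \<Rightarrow> real) \<Rightarrow> ('a \<Rightarrow> 'a) \<Rightarrow> 'a \<Rightarrow> 'a" where
  "symmetric_part_on V g D x = (1/2) *\<^sub>R (D x + adjoint_on V g D x)"


section \<open>Lie algebras and invariant forms\<close>

definition lie_algebra_on :: "'a::real_vector set \<Rightarrow> ('a \<Rightarrow> 'a \<Rightarrow> 'a) \<Rightarrow> bool" where
  "lie_algebra_on V br \<longleftrightarrow> subspace V \<and> (\<forall>x\<in>V. \<forall>y\<in>V. br x y \<in> V) \<and> bilinear_on V br \<and>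
     (\<forall>x\<in>V. br x x = 0) \<and>
     (\<forall>x\<in>V. \<forall>y\<in>V. \<forall>z\<in>V. br x (br y z) + br y (br z x) + br z (br x y) = 0)"

definition lie_subalgebra :: "'a::real_vector set \<Rightarrow> ('a \<Rightarrow> 'a \<Rightarrow> 'a) \<Rightarrow> bool" where
  "lie_subalgebra W br \<longleftrightarrow> subspace W \<and> (\<forall>x\<in>W. \<forall>y\<in>W. br x y \<in> W)"

definition derivation_on :: "'a::real_vector set \<Rightarrow> ('a \<Rightarrow> 'a \<Rightarrow> 'a) \<Rightarrow> ('a \<Rightarrow> 'a) \<Rightarrow> bool" where
  "derivation_on V br D \<longleftrightarrow> endomorphism_on V D \<and>
     (\<forall>x\<in>V. \<forall>y\<in>V. D (br x y) = br (D x) y + br x (D y))"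

definition d_one_form :: "('a \<Rightarrow> 'a \<Rightarrow> 'a) \<Rightarrow> ('a \<Rightarrow> real) \<Rightarrow> 'a \<Rightarrow> 'a \<Rightarrow> real" where
  "d_one_form br \<eta> x y = - \<eta> (br x y)"

definition d_two_form ::
    "('a \<Rightarrow> 'a \<Rightarrow> 'a) \<Rightarrow> ('a \<Rightarrow> 'a \<Rightarrow> real) \<Rightarrow> 'a \<Rightarrow> 'a \<Rightarrow> 'a \<Rightarrow> real" where
  "d_two_form br \<omega> x y z = - \<omega> (br x y) z - \<omega> (br y z) x - \<omega> (br z x) y"

definition wedge_one_two ::
    "('a \<Rightarrow> real) \<Rightarrow> ('a \<Rightarrow> 'a \<Rightarrow> real) \<Rightarrow> 'a \<Rightarrow> 'a \<Rightarrow> 'a \<Rightarrow> real" where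
  "wedge_one_two \<eta> \<omega> x y z = \<eta> x * \<omega> y z + \<eta> y * \<omega> z x + \<eta> z * \<omega> x y"

definition fundamental_form :: "('a \<Rightarrow> 'a \<Rightarrow> real) \<Rightarrow> ('a \<Rightarrow> 'a) \<Rightarrow> 'a \<Rightarrow> 'a \<Rightarrow> real" where
  "fundamental_form g \<phi> x y = g x (\<phi> y)"


section \<open>Almost contact metric structures\<close>

abbreviation Ker :: "('a \<Rightarrow> real) \<Rightarrow> 'a set" where
  "Ker \<eta> \<equiv> {x. \<eta> x = 0}"

definition almost_contact_metric ::
    "('a::real_vector \<Rightarrow> 'a) \<Rightarrow> 'a \<Rightarrow> ('a \<Rightarrow> real) \<Rightarrow> ('a \<Rightarrow> 'a \<Rightarrow> real) \<Rightarrow> bool" where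
  "almost_contact_metric \<phi> \<xi> \<eta> g \<longleftrightarrow>
     linear \<phi> \<and> linear \<eta> \<and> inner_product_on UNIV g \<and>
     (\<forall>x. \<phi> (\<phi> x) = - x + \<eta> x *\<^sub>R \<xi>) \<and> \<eta> \<xi> = 1 \<and>
     (\<forall>x y. g (\<phi> x) (\<phi> y) = g x y - \<eta> x * \<eta> y)"

text \<open>Since \<open>dim\<close> is \<open>0\<close> on infinite-dimensional spaces, the dimension condition includes
  finite-dimensionality.\<close>

definition almost_contact_metric_lie_algebra ::
    "nat \<Rightarrow> ('a::real_vector \<Rightarrow> 'a \<Rightarrow> 'a) \<Rightarrow> ('a \<Rightarrow> 'a) \<Rightarrow> 'a \<Rightarrow> ('a \<Rightarrow> real) \<Rightarrow>
     ('a \<Rightarrow> 'a \<Rightarrow> real) \<Rightarrow> bool" where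
  "almost_contact_metric_lie_algebra n br \<phi> \<xi> \<eta> g \<longleftrightarrow>
     lie_algebra_on UNIV br \<and> dim (UNIV :: 'a set) = 2 * n + 1 \<and> almost_contact_metric \<phi> \<xi> \<eta> g"

definition abelian_almost_contact ::
    "('a::real_vector \<Rightarrow> 'a \<Rightarrow> 'a) \<Rightarrow> ('a \<Rightarrow> 'a) \<Rightarrow> 'a \<Rightarrow> ('a \<Rightarrow> real) \<Rightarrow> bool" where
  "abelian_almost_contact br \<phi> \<xi> \<eta> \<longleftrightarrow>
     (\<forall>x. br \<xi> (\<phi> x) = \<phi> (br \<xi> x)) \<and>
     (\<forall>x y. \<eta> x = 0 \<longrightarrow> \<eta> y = 0 \<longrightarrow> br (\<phi> x) (\<phi> y) = br x y)"

definition nijenhuis ::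
    "('a::real_vector \<Rightarrow> 'a \<Rightarrow> 'a) \<Rightarrow> ('a \<Rightarrow> 'a) \<Rightarrow> 'a \<Rightarrow> 'a \<Rightarrow> 'a" where
  "nijenhuis br \<phi> x y = br (\<phi> x) (\<phi> y) + \<phi> (\<phi> (br x y)) - \<phi> (br (\<phi> x) y) - \<phi> (br x (\<phi> y))"

definition normal_almost_contact ::
    "('a::real_vector \<Rightarrow> 'a \<Rightarrow> 'a) \<Rightarrow> ('a \<Rightarrow> 'a) \<Rightarrow> 'a \<Rightarrow> ('a \<Rightarrow> real) \<Rightarrow> bool" where
  "normal_almost_contact br \<phi> \<xi> \<eta> \<longleftrightarrow>
     (\<forall>x y. nijenhuis br \<phi> x y + d_one_form br \<eta> x y *\<^sub>R \<xi> = 0)"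

definition alpha_coKaehler ::
    "real \<Rightarrow> ('a::real_vector \<Rightarrow> 'a \<Rightarrow> 'a) \<Rightarrow> ('a \<Rightarrow> 'a) \<Rightarrow> 'a \<Rightarrow> ('a \<Rightarrow> real) \<Rightarrow>
     ('a \<Rightarrow> 'a \<Rightarrow> real) \<Rightarrow> bool" where
  "alpha_coKaehler \<alpha> br \<phi> \<xi> \<eta> g \<longleftrightarrow>
     almost_contact_metric \<phi> \<xi> \<eta> g \<and> normal_almost_contact br \<phi> \<xi> \<eta> \<and>
     (\<forall>x y. d_one_form br \<eta> x y = 0) \<and>
     (\<forall>x y z. d_two_form br (fundamental_form g \<phi>) x y z
              = 2 * \<alpha> * wedge_one_two \<eta> (fundamental_form g \<phi>) x y z)"

definition abelian_Kaehler_on ::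
    "'a::real_vector set \<Rightarrow> ('a \<Rightarrow> 'a \<Rightarrow> 'a) \<Rightarrow> ('a \<Rightarrow> 'a) \<Rightarrow> ('a \<Rightarrow> 'a \<Rightarrow> real) \<Rightarrow> bool" where
  "abelian_Kaehler_on V br J g \<longleftrightarrow>
     lie_algebra_on V br \<and> endomorphism_on V J \<and> (\<forall>x\<in>V. J (J x) = - x) \<and>
     (\<forall>x\<in>V. \<forall>y\<in>V. br (J x) (J y) = br x y) \<and>
     inner_product_on V g \<and> (\<forall>x\<in>V. \<forall>y\<in>V. g (J x) (J y) = g x y) \<and>
     (\<forall>x\<in>V. \<forall>y\<in>V. \<forall>z\<in>V. d_two_form br (fundamental_form g J) x y z = 0)"


section \<open>Well-definedness of the adjoint and of the restriction of \<open>ad\<close>\<close>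

lemma riesz_on_span:
  assumes "finite B"
  shows "inner_product_on (span B) g \<Longrightarrow> linear_on (span B) f \<Longrightarrow>
           \<exists>z\<in>span B. \<forall>y\<in>span B. f y = g z (y::'a::real_vector)" 
  using assms
proof (induction B arbitrary: f rule: finite_induct)
  case empty
  have "f 0 = (0::real)" "g 0 0 = 0"
    using empty unfolding linear_on_def inner_product_on_def bilinear_on_def
    by (metis insertI1 real_vector.span_empty scale_zero_left)+
  then show ?case by simp
next
  case (insert b B)
  let ?V = "span (insert b B)"
  have sub: "span B \<subseteq> ?V" by (simp add: span_mono subset_insertI)
  have bV: "b \<in> ?V" by (simp add: span_base)
  have gB: "inner_product_on (span B) g"
    using insert.prems(1) sub unfolding inner_product_on_def bilinear_on_def linear_on_def
    by (meson subsetD)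
  have fB: "linear_on (span B) f"
    using insert.prems(2) sub unfolding linear_on_def by (meson subsetD)
  have lb: "linear_on (span B) (g b)"
    using insert.prems(1) sub bV unfolding inner_product_on_def bilinear_on_def linear_on_def
    by (meson subsetD)
  obtain z where z: "z \<in> span B" "\<And>y. y \<in> span B \<Longrightarrow> f y = g z y"
    using insert.IH[OF gB fB] by blast
  obtain p where p: "p \<in> span B" "\<And>y. y \<in> span B \<Longrightarrow> g b y = g p y"
    using insert.IH[OF gB lb] by blast
  define e where "e = b - p"
  have eV: "e \<in> ?V" unfolding e_def using bV p(1) sub by (metis span_diff subsetD)
  have addl: "g (x + y) w = g x w + g y w" and addr: "g w (x + y) = g w x + g w y"
    and scl: "g (c *\<^sub>R x) w = c * g x w" and scr: "g w (c *\<^sub>R x) = c * g w x"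
    and sym: "g x w = g w x"
    if "x \<in> ?V" "y \<in> ?V" "w \<in> ?V" for x y w c
    using insert.prems(1) that unfolding inner_product_on_def bilinear_on_def linear_on_def
    by simp_all
  have fadd: "f (x + y) = f x + f y" and fsc: "f (c *\<^sub>R x) = c * f x"
    if "x \<in> ?V" "y \<in> ?V" for x y c
    using insert.prems(2) that unfolding linear_on_def by simp_all
  have orth: "g e y = 0" if "y \<in> span B" for y
  proof -
    have "g b y = g (e + p) y" by (simp add: e_def)
    also have "\<dots> = g e y + g p y" using addl eV p(1) sub that by blast
    finally show ?thesis using p(2)[OF that] by simp
  qed
  show ?case
  proof (cases "e = 0")
    case True
    then have "b \<in> span B" using p(1) by (simp add: e_def)
    then have "?V = span B" by (simp add: span_redundant)
    then show ?thesis using z by auto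
  next
    case False
    then have gee: "g e e \<noteq> 0"
      using insert.prems(1) eV unfolding inner_product_on_def by (metis less_irrefl)
    define t where "t = f e / g e e"
    have zV: "z + t *\<^sub>R e \<in> ?V"
      using z(1) sub eV by (metis span_add span_scale subsetD)
    have "f y = g (z + t *\<^sub>R e) y" if y: "y \<in> ?V" for y
    proof -
      obtain k where k: "y - k *\<^sub>R b \<in> span B"
        using y by (auto simp: span_breakdown_eq)
      define w where "w = y - k *\<^sub>R b + k *\<^sub>R p"
      have w: "w \<in> span B" unfolding w_def using k p(1) by (metis span_add span_scale)
      have wV: "w \<in> ?V" and zV': "z \<in> ?V" using w z(1) sub by auto
      have keV: "k *\<^sub>R e \<in> ?V" and teV: "t *\<^sub>R e \<in> ?V" using eV by (simp_all add: span_scale)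
      have y_eq: "y = w + k *\<^sub>R e" by (simp add: w_def e_def algebra_simps)
      have "f y = f w + k * f e"
        unfolding y_eq using fadd[OF wV keV] fsc[OF eV eV] by simp
      moreover have "g z y = g z w"
        unfolding y_eq using addr[OF wV keV zV'] scr[OF eV eV zV'] sym[OF eV eV zV'] orth[OF z(1)]
        by simp
      moreover have "g e y = k * g e e"
        unfolding y_eq using addr[OF wV keV eV] scr[OF eV eV eV] orth[OF w] by simp
      moreover have "g (z + t *\<^sub>R e) y = g z y + t * g e y"
        using addl[OF zV' teV y] scl[OF eV eV y] by simp
      ultimately show ?thesis using z(2)[OF w] gee by (simp add: t_def)
    qed
    then show ?thesis using zV by blast
  qed
qed

lemma inner_product_on_eqI:
  assumes V: "subspace V" and g: "inner_product_on V g" and "a \<in> V" "b \<in> V"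
    and eq: "\<And>x. x \<in> V \<Longrightarrow> g x a = g x b"
  shows "a = b"
proof (rule ccontr)
  assume "a \<noteq> b"
  define c where "c = a - b"
  have cV: "c \<in> V" using assms by (simp add: c_def subspace_diff)
  have "g c (c + b) = g c c + g c b"
    using g cV \<open>b \<in> V\<close> unfolding inner_product_on_def bilinear_on_def linear_on_def by blast
  then have "g c c = 0" using eq[OF cV] by (simp add: c_def)
  moreover have "g c c > 0"
    using g cV \<open>a \<noteq> b\<close> unfolding inner_product_on_def by (simp add: c_def)
  ultimately show False by simp
qed

lemma adjoint_on:
  fixes V :: "'a::real_vector set"
  assumes V: "V = span B" "finite B" and g: "inner_product_on V g" and D: "endomorphism_on V D"
  shows "endomorphism_on V (adjoint_on V g D)"
    and "\<lbrakk>x \<in> V; y \<in> V\<rbrakk> \<Longrightarrow> g (D x) y = g x (adjoint_on V g D y)"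
proof -
  have sV: "subspace V" by (simp add: V(1))
  have addV: "a + b \<in> V" and scV: "c *\<^sub>R a \<in> V" if "a \<in> V" "b \<in> V" for a b c
    using sV that by (auto intro: subspace_add subspace_scale)
  have DV: "D x \<in> V" if "x \<in> V" for x using D that unfolding endomorphism_on_def by blast
  have addr: "g w (x + y) = g w x + g w y" and scr: "g w (c *\<^sub>R x) = c * g w x"
    and addl: "g (x + y) w = g x w + g y w" and scl: "g (c *\<^sub>R x) w = c * g x w"
    and sym: "g x w = g w x"
    if "x \<in> V" "y \<in> V" "w \<in> V" for x y w c
    using g that unfolding inner_product_on_def bilinear_on_def linear_on_def by simp_all
  have Dadd: "D (x + y) = D x + D y" and Dsc: "D (c *\<^sub>R x) = c *\<^sub>R D x"
    if "x \<in> V" "y \<in> V" for x y c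
    using D that unfolding endomorphism_on_def linear_on_def by simp_all
  have "\<forall>y\<in>V. \<exists>z\<in>V. \<forall>x\<in>V. g (D x) y = g z x"
  proof
    fix y assume y: "y \<in> V"
    have "linear_on V (\<lambda>x. g (D x) y)"
      unfolding linear_on_def using y DV Dadd Dsc addl scl by simp
    then show "\<exists>z\<in>V. \<forall>x\<in>V. g (D x) y = g z x"
      using riesz_on_span[OF V(2), of g "\<lambda>x. g (D x) y"] g V(1) by simp
  qed
  then obtain D' where D': "\<And>y. y \<in> V \<Longrightarrow> D' y \<in> V"
    "\<And>x y. y \<in> V \<Longrightarrow> x \<in> V \<Longrightarrow> g (D x) y = g (D' y) x"
    by metis
  have D'eq: "g (D x) y = g x (D' y)" if "x \<in> V" "y \<in> V" for x y
    using that D' sym by metis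
  have "D' (a + b) = D' a + D' b" if "a \<in> V" "b \<in> V" for a b
    by (rule inner_product_on_eqI[OF sV g])
       (use that D'(1) addV addr DV in \<open>simp_all flip: D'eq\<close>)
  moreover have "D' (c *\<^sub>R a) = c *\<^sub>R D' a" if "a \<in> V" for a c
    by (rule inner_product_on_eqI[OF sV g])
       (use that D'(1) scV scr DV in \<open>simp_all flip: D'eq\<close>)
  ultimately have "endomorphism_on V D' \<and> (\<forall>x\<in>V. \<forall>y\<in>V. g (D x) y = g x (D' y))"
    unfolding endomorphism_on_def linear_on_def using D'(1) D'eq by simp
  from someI[of "\<lambda>D'. endomorphism_on V D' \<and> (\<forall>x\<in>V. \<forall>y\<in>V. g (D x) y = g x (D' y))", OF this]
  have *: "endomorphism_on V (adjoint_on V g D) \<and>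
           (\<forall>x\<in>V. \<forall>y\<in>V. g (D x) y = g x (adjoint_on V g D y))"
    unfolding adjoint_on_def .
  show "endomorphism_on V (adjoint_on V g D)" using * by blast
  show "\<lbrakk>x \<in> V; y \<in> V\<rbrakk> \<Longrightarrow> g (D x) y = g x (adjoint_on V g D y)" using * by blast
qed

lemma adjoint_on_unique:
  fixes V :: "'a::real_vector set"
  assumes V: "V = span B" "finite B" and g: "inner_product_on V g" and D: "endomorphism_on V D"
    and D': "endomorphism_on V D'" "\<And>x y. x \<in> V \<Longrightarrow> y \<in> V \<Longrightarrow> g (D x) y = g x (D' y)"
    and y: "y \<in> V"
  shows "adjoint_on V g D y = D' y"
proof (rule inner_product_on_eqI[OF _ g])
  show "subspace V" by (simp add: V(1))
  show "adjoint_on V g D y \<in> V" "D' y \<in> V"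
    using adjoint_on(1)[OF V g D] D'(1) y unfolding endomorphism_on_def by blast+
  show "g x (adjoint_on V g D y) = g x (D' y)" if "x \<in> V" for x
    using adjoint_on(2)[OF V g D that y] D'(2)[OF that y] by simp
qed

lemma almost_contact_metric_eta_phi:
  assumes "almost_contact_metric \<phi> \<xi> \<eta> g"
  shows "\<phi> \<xi> = 0" "\<eta> (\<phi> x) = 0"
proof -
  have lin: "linear \<phi>" "linear \<eta>" and sq: "\<And>x. \<phi> (\<phi> x) = - x + \<eta> x *\<^sub>R \<xi>" and one: "\<eta> \<xi> = 1"
    using assms unfolding almost_contact_metric_def by blast+
  have key: "\<eta> (\<phi> y) *\<^sub>R \<xi> = \<eta> y *\<^sub>R \<phi> \<xi>" for y
  proof -
    have "\<phi> (\<phi> (\<phi> y)) = \<phi> (- y + \<eta> y *\<^sub>R \<xi>)" by (simp only: sq)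
    also have "\<dots> = - \<phi> y + \<eta> y *\<^sub>R \<phi> \<xi>"
      using lin(1) by (simp only: linear_add linear_neg linear_scale)
    finally show ?thesis using sq[of "\<phi> y"] by simp
  qed
  have k\<xi>: "\<phi> \<xi> = \<eta> (\<phi> \<xi>) *\<^sub>R \<xi>" using key[of \<xi>] one by simp
  have "\<phi> (\<phi> \<xi>) = 0" using sq[of \<xi>] one by simp
  moreover have "\<phi> (\<phi> \<xi>) = \<eta> (\<phi> \<xi>) *\<^sub>R \<phi> \<xi>" using k\<xi> lin(1) by (metis linear_scale)
  ultimately show 0: "\<phi> \<xi> = 0" using k\<xi> by (metis scale_eq_0_iff scale_zero_left)
  have "\<xi> \<noteq> 0" using one lin(2) linear_0 by fastforce
  then show "\<eta> (\<phi> x) = 0" using key[of x] 0 by simp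
qed

lemma derivation_on_ad_xi:
  assumes acm: "almost_contact_metric_lie_algebra n br \<phi> \<xi> \<eta> g"
    and ab: "abelian_almost_contact br \<phi> \<xi> \<eta>"
  shows "derivation_on (Ker \<eta>) br (br \<xi>)"
proof -
  have lie: "lie_algebra_on UNIV br" and ac: "almost_contact_metric \<phi> \<xi> \<eta> g"
    using acm unfolding almost_contact_metric_lie_algebra_def by blast+
  have lin: "linear \<phi>" and sq: "\<And>x. \<phi> (\<phi> x) = - x + \<eta> x *\<^sub>R \<xi>"
    using ac unfolding almost_contact_metric_def by blast+
  have add: "br a (x + y) = br a x + br a y" "br (x + y) a = br x a + br y a"
    and sc: "br a (c *\<^sub>R x) = c *\<^sub>R br a x" and alt: "br a a = 0"
    and jac: "br x (br y z) + br y (br z x) + br z (br x y) = 0" for a x y z c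
    using lie unfolding lie_algebra_on_def bilinear_on_def linear_on_def by simp_all
  have neg: "br a (- x) = - br a x" for a x using sc[of a "-1" x] by simp
  have anti: "br x y = - br y x" for x y
  proof -
    have "br (x + y) (x + y) = br x x + br x y + (br y x + br y y)" by (simp add: add)
    then show ?thesis by (simp add: alt eq_neg_iff_add_eq_0)
  qed
  have pres: "\<eta> (br \<xi> x) = 0" if "\<eta> x = 0" for x
  proof -
    have "br \<xi> x = - br \<xi> (\<phi> (\<phi> x))" using sq[of x] that by (simp add: neg)
    also have "\<dots> = \<phi> (- br \<xi> (\<phi> x))"
      using ab lin unfolding abelian_almost_contact_def by (simp add: linear_neg)
    finally show ?thesis using almost_contact_metric_eta_phi(2)[OF ac] by simp
  qed
  have leib: "br \<xi> (br x y) = br (br \<xi> x) y + br x (br \<xi> y)" for x y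
    using jac[of \<xi> x y] anti[of y \<xi>] anti[of y "br \<xi> x"] neg[of x "br \<xi> y"]
    by (simp add: algebra_simps)
  show ?thesis
    unfolding derivation_on_def endomorphism_on_def linear_on_def
    using pres leib add sc by simp
qed

end

theory Submission
  imports Defs
begin

text \<open>Since \<open>ad\<^sub>\<xi>\<close> commutes with \<open>\<phi>\<close>, it preserves \<open>Ker \<eta>\<close>; hence \<open>d\<eta> = 0\<close> says exactly that
  \<open>Ker \<eta>\<close> is a subalgebra. Split vectors as \<open>x + a\<xi>\<close> with \<open>x \<in> Ker \<eta>\<close>. The equation
  \<open>d\<Phi> = 2\<alpha> \<eta> \<and> \<Phi>\<close> on three vectors of \<open>Ker \<eta>\<close> is the Kaehler condition. On \<open>\<xi>, x, z\<close> it reads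
  \<open>g (ad\<^sub>\<xi> z) (\<phi> x) - g (ad\<^sub>\<xi> x) (\<phi> z) = 2\<alpha> g x (\<phi> z)\<close>, and moving \<open>\<phi>\<close> across \<open>g\<close> and \<open>ad\<^sub>\<xi>\<close> turns
  this, for \<open>y = \<phi> z\<close>, into \<open>g (ad\<^sub>\<xi> x) y + g x (ad\<^sub>\<xi> y) = -2\<alpha> g x y\<close>.\<close>

section \<open>Symmetric parts in finite dimension\<close>

lemma subspace_finite_basis:
  fixes V :: "'a::real_vector set"
  assumes V: "subspace V" and dim: "dim (UNIV :: 'a set) \<noteq> 0"
  obtains B where "finite B" "V = span B"
proof -
  obtain C :: "'a set" where C: "independent C" "UNIV \<subseteq> span C" "card C = dim (UNIV :: 'a set)"
    using real_vector.basis_exists[of UNIV] by blast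
  \<comment> \<open>\<open>card\<close> of an infinite set is 0, so a non-zero dimension makes
    \<open>C\<close> finite.\<close>
  then have finC: "finite C" using dim by (metis card.infinite)
  obtain B where B: "B \<subseteq> V" "independent B" "V \<subseteq> span B"
    by (rule real_vector.basis_exists)
  have "B \<subseteq> span C" using C(2) by (rule order_trans[OF subset_UNIV])
  then have "finite B"
    using real_vector.independent_span_bound[OF finC B(2)] by blast
  moreover have "V = span B"
    using B(3) real_vector.span_minimal[OF B(1) V] by (rule subset_antisym)
  ultimately show thesis by (rule that)
qed

text \<open>Pairing with \<open>g\<close> moves the adjoint to \<open>D\<close> on the other
  argument, which removes the chosen adjoint from the condition; definiteness of \<open>g\<close>
  recovers the vector equation from its pairings.\<close>

lemma symmetric_part_on_eq_scaleR_iff: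
  fixes V :: "'a::real_vector set"
  assumes V: "V = span B" "finite B" and g: "inner_product_on V g" and D: "endomorphism_on V D"
  shows "(\<forall>x\<in>V. symmetric_part_on V g D x = c *\<^sub>R x) \<longleftrightarrow>
         (\<forall>x\<in>V. \<forall>y\<in>V. g (D x) y + g x (D y) = 2 * c * g x y)"
proof -
  have sV: "subspace V" by (simp add: V(1))
  note adj = adjoint_on[OF V g D]
  have DV: "D x \<in> V" and D'V: "adjoint_on V g D x \<in> V" if "x \<in> V" for x
    using D adj(1) that unfolding endomorphism_on_def by blast+
  have g_add: "g w (x + y) = g w x + g w y" and g_scale: "g w (k *\<^sub>R x) = k * g w x"
    and g_sym: "g x w = g w x"
    if "x \<in> V" "y \<in> V" "w \<in> V" for x y w k
    using g that unfolding inner_product_on_def bilinear_on_def linear_on_def by simp_all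
  have symV: "symmetric_part_on V g D x \<in> V" if "x \<in> V" for x
    unfolding symmetric_part_on_def using DV D'V that sV
    by (simp add: subspace_add subspace_scale)
  have key: "2 * g x (symmetric_part_on V g D y) = g (D x) y + g x (D y)"
    if "x \<in> V" "y \<in> V" for x y
  proof -
    have "D y + adjoint_on V g D y \<in> V" using DV D'V that sV by (simp add: subspace_add)
    then show ?thesis
      unfolding symmetric_part_on_def
      using that DV D'V adj(2)[OF that] g_add g_scale by simp
  qed
  show ?thesis
  proof
    assume "\<forall>x\<in>V. symmetric_part_on V g D x = c *\<^sub>R x"
    then show "\<forall>x\<in>V. \<forall>y\<in>V. g (D x) y + g x (D y) = 2 * c * g x y"
      using key g_scale by (simp flip: key)
  next
    assume *: "\<forall>x\<in>V. \<forall>y\<in>V. g (D x) y + g x (D y) = 2 * c * g x y"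
    show "\<forall>x\<in>V. symmetric_part_on V g D x = c *\<^sub>R x"
    proof
      fix y assume y: "y \<in> V"
      show "symmetric_part_on V g D y = c *\<^sub>R y"
      proof (rule inner_product_on_eqI[OF sV g symV[OF y]])
        show "c *\<^sub>R y \<in> V" using sV y by (rule subspace_scale)
        show "g x (symmetric_part_on V g D y) = g x (c *\<^sub>R y)" if "x \<in> V" for x
          using key[OF that y] * that y g_scale by simp
      qed
    qed
  qed
qed

section \<open>Calculus of the structure tensors\<close>

locale abelian_contact_metric_lie_algebra =
  fixes br :: "'a::real_vector \<Rightarrow> 'a \<Rightarrow> 'a"
    and \<phi> :: "'a \<Rightarrow> 'a" and \<xi> :: 'a and \<eta> :: "'a \<Rightarrow> real" and g :: "'a \<Rightarrow> 'a \<Rightarrow> real"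
    and n :: nat
  assumes acm: "almost_contact_metric_lie_algebra n br \<phi> \<xi> \<eta> g"
    and abelian: "abelian_almost_contact br \<phi> \<xi> \<eta>"
begin

lemma ac: "almost_contact_metric \<phi> \<xi> \<eta> g"
  using acm unfolding almost_contact_metric_lie_algebra_def by blast

lemma lie: "lie_algebra_on UNIV br"
  using acm unfolding almost_contact_metric_lie_algebra_def by blast

lemma phi_linear: "linear \<phi>" and eta_linear: "linear \<eta>" and ip: "inner_product_on UNIV g"
  and phi_phi: "\<phi> (\<phi> x) = - x + \<eta> x *\<^sub>R \<xi>" and eta_xi: "\<eta> \<xi> = 1"
  and g_phi_phi: "g (\<phi> x) (\<phi> y) = g x y - \<eta> x * \<eta> y"
  using ac unfolding almost_contact_metric_def by blast+

lemmas phi_xi = almost_contact_metric_eta_phi(1)[OF ac]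
lemmas eta_phi = almost_contact_metric_eta_phi(2)[OF ac]

lemmas phi_simps = linear_0[OF phi_linear] linear_add[OF phi_linear] linear_diff[OF phi_linear]
  linear_neg[OF phi_linear] linear_scale[OF phi_linear] phi_xi
lemmas eta_simps = linear_0[OF eta_linear] linear_add[OF eta_linear] linear_diff[OF eta_linear]
  linear_neg[OF eta_linear] linear_scale[OF eta_linear] eta_xi eta_phi

lemma br_simps:
  "br x (y + z) = br x y + br x z" "br (y + z) x = br y x + br z x"
  "br x (c *\<^sub>R y) = c *\<^sub>R br x y" "br (c *\<^sub>R y) x = c *\<^sub>R br y x" "br x x = 0"
  using lie unfolding lie_algebra_on_def bilinear_on_def linear_on_def by simp_all

lemma br_minus: "br x (- y) = - br x y" "br (- y) x = - br y x"
  using br_simps(3)[of x "-1" y] br_simps(4)[of "-1" y x] by simp_all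

lemma br_anti: "br x y = - br y x"
proof -
  have "br x y + br y x = 0"
    using br_simps(5)[of "x + y"] unfolding br_simps(1,2) by (simp add: br_simps(5) add.commute)
  then show ?thesis by (simp add: eq_neg_iff_add_eq_0)
qed

lemma g_simps:
  "g x (y + z) = g x y + g x z" "g (y + z) x = g y x + g z x"
  "g x (c *\<^sub>R y) = c * g x y" "g (c *\<^sub>R y) x = c * g y x"
  using ip unfolding inner_product_on_def bilinear_on_def linear_on_def by simp_all

lemma g_minus: "g x (- y) = - g x y" "g (- y) x = - g y x"
  using g_simps(3)[of x "-1" y] g_simps(4)[of "-1" y x] by simp_all

lemma g_diff: "g x (y - z) = g x y - g x z" "g (y - z) x = g y x - g z x"
  using g_simps(1)[of x y "- z"] g_simps(2)[of y "- z" x] by (simp_all add: g_minus)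

lemma g_sym: "g x y = g y x"
  using ip unfolding inner_product_on_def by simp

lemma g_xi_phi: "g \<xi> (\<phi> x) = 0"
  \<comment> \<open>The second instance has scalar and vector zero: it only says that
    \<open>g 0\<close> vanishes, as needed after \<open>\<phi> \<xi> = 0\<close>.\<close>
  using g_phi_phi[of \<xi> "\<phi> x"] g_simps(4)[of 0 0 "\<phi> (\<phi> x)"]
  by (simp add: phi_xi eta_phi)

text \<open>Compatibility is applied to \<open>x\<close> and \<open>\<phi> y\<close>; the
  \<xi>-component of \<open>\<phi> (\<phi> y)\<close> drops out because the image of \<phi> is
  orthogonal to \<xi>.\<close>

lemma g_phi_skew: "g (\<phi> x) y = - g x (\<phi> y)"
  using g_phi_phi[of x "\<phi> y"]
  by (simp add: phi_phi eta_phi g_simps g_diff g_minus g_sym[of "\<phi> x" \<xi>] g_xi_phi)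

lemma ad_xi_phi: "br \<xi> (\<phi> x) = \<phi> (br \<xi> x)"
  using abelian unfolding abelian_almost_contact_def by blast

lemma br_phi_phi: "\<eta> x = 0 \<Longrightarrow> \<eta> y = 0 \<Longrightarrow> br (\<phi> x) (\<phi> y) = br x y"
  using abelian unfolding abelian_almost_contact_def by blast

lemma ad_xi_endomorphism: "endomorphism_on (Ker \<eta>) (br \<xi>)"
  using derivation_on_ad_xi[OF acm abelian] unfolding derivation_on_def by blast

lemma eta_ad_xi: "\<eta> x = 0 \<Longrightarrow> \<eta> (br \<xi> x) = 0"
  using ad_xi_endomorphism unfolding endomorphism_on_def by blast

lemma subspace_Ker: "subspace (Ker \<eta>)"
  by (auto simp: subspace_def eta_simps)

lemma Ker_xi_decomposition:
  obtains x' where "\<eta> x' = 0" "x = x' + \<eta> x *\<^sub>R \<xi>"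
proof
  show "\<eta> (x - \<eta> x *\<^sub>R \<xi>) = 0" by (simp add: eta_simps)
qed simp

lemma br_decomposition:
  "br (x + a *\<^sub>R \<xi>) (y + b *\<^sub>R \<xi>) = br x y + a *\<^sub>R br \<xi> y - b *\<^sub>R br \<xi> x"
  using br_anti[of x \<xi>] by (simp add: br_simps)

section \<open>Closedness of \<eta> and normality\<close>

lemma eta_br_eq_0_iff: "(\<forall>x y. \<eta> (br x y) = 0) \<longleftrightarrow> lie_subalgebra (Ker \<eta>) br"
proof
  assume "lie_subalgebra (Ker \<eta>) br"
  then have h: "\<eta> (br x y) = 0" if "\<eta> x = 0" "\<eta> y = 0" for x y
    using that unfolding lie_subalgebra_def by blast
  show "\<forall>x y. \<eta> (br x y) = 0"
  proof (intro allI)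
    fix x y
    obtain x' where x: "\<eta> x' = 0" "x = x' + \<eta> x *\<^sub>R \<xi>" by (rule Ker_xi_decomposition)
    obtain y' where y: "\<eta> y' = 0" "y = y' + \<eta> y *\<^sub>R \<xi>" by (rule Ker_xi_decomposition)
    have "br x y = br x' y' + \<eta> x *\<^sub>R br \<xi> y' - \<eta> y *\<^sub>R br \<xi> x'"
      using br_decomposition x(2) y(2) by metis
    then show "\<eta> (br x y) = 0" using h x(1) y(1) by (simp add: eta_simps eta_ad_xi)
  qed
qed (auto simp: lie_subalgebra_def subspace_Ker)

text \<open>The terms with \<open>br \<xi>\<close> cancel since it commutes with \<phi>. On the
  kernel the two mixed brackets cancel each other, and what remains of the Nijenhuis term is
  \<open>\<eta> (br x' y') *\<^sub>R \<xi>\<close>, which the \<open>d\<eta>\<close> term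
  removes.\<close>

lemma normal: "normal_almost_contact br \<phi> \<xi> \<eta>"
  unfolding normal_almost_contact_def
proof (intro allI)
  fix x y
  obtain x' where x: "\<eta> x' = 0" "x = x' + \<eta> x *\<^sub>R \<xi>" by (rule Ker_xi_decomposition)
  obtain y' where y: "\<eta> y' = 0" "y = y' + \<eta> y *\<^sub>R \<xi>" by (rule Ker_xi_decomposition)
  let ?a = "\<eta> x" and ?b = "\<eta> y"
  have phi_x: "\<phi> x = \<phi> x'" and phi_y: "\<phi> y = \<phi> y'"
    by (subst x(2), simp add: phi_simps) (subst y(2), simp add: phi_simps)
  have brxy: "br x y = br x' y' + ?a *\<^sub>R br \<xi> y' - ?b *\<^sub>R br \<xi> x'"
    using br_decomposition x(2) y(2) by metis
  have br1: "br (\<phi> x) y = br (\<phi> x') y' - ?b *\<^sub>R \<phi> (br \<xi> x')"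
    using br_decomposition[of "\<phi> x'" 0 y' ?b] y(2) phi_x by (simp add: ad_xi_phi)
  have br2: "br x (\<phi> y) = br x' (\<phi> y') + ?a *\<^sub>R \<phi> (br \<xi> y')"
    using br_decomposition[of x' ?a "\<phi> y'" 0] x(2) phi_y by (simp add: ad_xi_phi)
  \<comment> \<open>The abelian identity for \<open>x'\<close> and \<open>\<phi> y'\<close>, where
    \<phi> squares to minus the identity.\<close>
  have cross: "br x' (\<phi> y') = - br (\<phi> x') y'"
    using br_phi_phi[of x' "\<phi> y'"] x(1) y(1) by (simp add: eta_phi phi_phi br_minus)
  show "nijenhuis br \<phi> x y + d_one_form br \<eta> x y *\<^sub>R \<xi> = 0"
    unfolding nijenhuis_def d_one_form_def br1 br2 brxy cross
    unfolding phi_x phi_y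
    using x(1) y(1)
    by (simp add: phi_simps phi_phi eta_simps br_phi_phi eta_ad_xi algebra_simps)
qed

section \<open>The exterior derivative of the fundamental form\<close>

lemma d_fundamental_form_xi:
  assumes "\<eta> z = 0"
  shows "d_two_form br (fundamental_form g \<phi>) \<xi> x z = - g (br \<xi> x) (\<phi> z) - g x (br \<xi> (\<phi> z))"
  \<comment> \<open>The bracket of \<open>x\<close> and \<open>z\<close> is paired with
    \<open>\<phi> \<xi> = 0\<close>, so only \<open>br \<xi>\<close> survives; skewness of \<phi>
    then makes the expression symmetric in \<open>x\<close> and \<open>\<phi> z\<close>.\<close>
  using assms
  by (simp add: d_two_form_def fundamental_form_def phi_xi br_anti[of z \<xi>] g_minus ad_xi_phi
      g_phi_skew g_sym[of x "\<phi> _"] g_simps(3)[of _ 0 0, simplified])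

text \<open>The derivative is trilinear and alternating: terms with two entries \<xi> vanish, and
  cyclic shifts bring a single \<xi> to the front.\<close>

lemma d_fundamental_form_decomposition:
  "d_two_form br (fundamental_form g \<phi>) (x + a *\<^sub>R \<xi>) (y + b *\<^sub>R \<xi>) (z + c *\<^sub>R \<xi>) =
    d_two_form br (fundamental_form g \<phi>) x y z
    + a * d_two_form br (fundamental_form g \<phi>) \<xi> y z
    + b * d_two_form br (fundamental_form g \<phi>) \<xi> z x
    + c * d_two_form br (fundamental_form g \<phi>) \<xi> x y"
proof -
  show ?thesis
    unfolding d_two_form_def fundamental_form_def br_decomposition
    using br_anti[of x \<xi>] br_anti[of y \<xi>] br_anti[of z \<xi>]
    by (simp add: phi_simps g_simps g_diff g_minus g_simps(3)[of _ 0 0, simplified] algebra_simps)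
qed

text \<open>\<xi> is in the radical of the fundamental form, so the \<xi>-components are seen by the
  factors \<eta> alone.\<close>

lemma wedge_fundamental_form_decomposition:
  assumes "\<eta> x = 0" "\<eta> y = 0" "\<eta> z = 0"
  shows "wedge_one_two \<eta> (fundamental_form g \<phi>) (x + a *\<^sub>R \<xi>) (y + b *\<^sub>R \<xi>) (z + c *\<^sub>R \<xi>) =
    a * g y (\<phi> z) + b * g z (\<phi> x) + c * g x (\<phi> y)"
  using assms
  by (simp add: wedge_one_two_def fundamental_form_def eta_simps phi_simps g_simps g_xi_phi)

lemma d_fundamental_form_eq_iff:
  "(\<forall>x y z. d_two_form br (fundamental_form g \<phi>) x y z
            = 2 * \<alpha> * wedge_one_two \<eta> (fundamental_form g \<phi>) x y z) \<longleftrightarrow>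
   (\<forall>x\<in>Ker \<eta>. \<forall>y\<in>Ker \<eta>. \<forall>z\<in>Ker \<eta>. d_two_form br (fundamental_form g \<phi>) x y z = 0) \<and>
   (\<forall>x\<in>Ker \<eta>. \<forall>y\<in>Ker \<eta>. g (br \<xi> x) y + g x (br \<xi> y) = 2 * (- \<alpha>) * g x y)"
  (is "?full \<longleftrightarrow> ?closed \<and> ?sym")
proof
  assume full: ?full
  have ?closed
    using full by (simp add: wedge_one_two_def)
  moreover have ?sym
  proof (intro ballI)
    fix x y assume xy: "x \<in> Ker \<eta>" "y \<in> Ker \<eta>"
    \<comment> \<open>Solves \<open>\<phi> z = y\<close> on the kernel, so the equation at
      \<open>\<xi>, x, z\<close> reaches every \<open>y\<close>.\<close>
    define z where "z = - \<phi> y"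
    have z: "\<eta> z = 0" "\<phi> z = y"
      using xy by (simp_all add: z_def eta_simps phi_simps phi_phi)
    have "d_two_form br (fundamental_form g \<phi>) \<xi> x z = 2 * \<alpha> * g x y"
      using full xy z by (simp add: wedge_one_two_def fundamental_form_def eta_xi)
    then show "g (br \<xi> x) y + g x (br \<xi> y) = 2 * (- \<alpha>) * g x y"
      using d_fundamental_form_xi[OF z(1), of x] z(2) by simp
  qed
  ultimately show "?closed \<and> ?sym" ..
next
  assume "?closed \<and> ?sym"
  then have closed: ?closed and ad_sym: ?sym by blast+
  have xi: "d_two_form br (fundamental_form g \<phi>) \<xi> x z = 2 * \<alpha> * g x (\<phi> z)"
    if "\<eta> x = 0" "\<eta> z = 0" for x z
  proof -
    have "g (br \<xi> x) (\<phi> z) + g x (br \<xi> (\<phi> z)) = 2 * (- \<alpha>) * g x (\<phi> z)"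
      using ad_sym that by (simp add: eta_phi)
    then show ?thesis using d_fundamental_form_xi[OF that(2), of x] by simp
  qed
  show ?full
  proof (intro allI)
    fix x y z
    obtain x' where x: "\<eta> x' = 0" "x = x' + \<eta> x *\<^sub>R \<xi>" by (rule Ker_xi_decomposition)
    obtain y' where y: "\<eta> y' = 0" "y = y' + \<eta> y *\<^sub>R \<xi>" by (rule Ker_xi_decomposition)
    obtain z' where z: "\<eta> z' = 0" "z = z' + \<eta> z *\<^sub>R \<xi>" by (rule Ker_xi_decomposition)
    show "d_two_form br (fundamental_form g \<phi>) x y z
          = 2 * \<alpha> * wedge_one_two \<eta> (fundamental_form g \<phi>) x y z"
      \<comment> \<open>Each equation has its left-hand side again on the right and would loop as a
        rewrite rule; it is used just once on either side of the goal.\<close>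
      apply (subst (1 2) x(2), subst (1 2) y(2), subst (1 2) z(2))
      using closed x(1) y(1) z(1)
      by (simp add: d_fundamental_form_decomposition wedge_fundamental_form_decomposition xi
          algebra_simps)
  qed
qed

section \<open>Restriction to the kernel and conclusion\<close>

lemma abelian_Kaehler_on_Ker_iff:
  assumes "lie_subalgebra (Ker \<eta>) br"
  shows "abelian_Kaehler_on (Ker \<eta>) br \<phi> g \<longleftrightarrow>
    (\<forall>x\<in>Ker \<eta>. \<forall>y\<in>Ker \<eta>. \<forall>z\<in>Ker \<eta>. d_two_form br (fundamental_form g \<phi>) x y z = 0)"
proof -
  \<comment> \<open>All Kaehler axioms except closedness are inherited: the \<eta>-terms in the
    contact identities vanish on the kernel.\<close>
  have "lie_algebra_on (Ker \<eta>) br"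
    using assms lie unfolding lie_subalgebra_def lie_algebra_on_def bilinear_on_def linear_on_def
    by simp
  moreover have "endomorphism_on (Ker \<eta>) \<phi>"
    unfolding endomorphism_on_def linear_on_def by (simp add: phi_simps eta_phi)
  moreover have "inner_product_on (Ker \<eta>) g"
    using ip unfolding inner_product_on_def bilinear_on_def linear_on_def by simp
  ultimately show ?thesis
    unfolding abelian_Kaehler_on_def by (simp add: phi_phi br_phi_phi g_phi_phi)
qed

lemma symmetric_part_ad_xi_iff:
  "(\<forall>x\<in>Ker \<eta>. symmetric_part_on (Ker \<eta>) g (br \<xi>) x = c *\<^sub>R x) \<longleftrightarrow>
   (\<forall>x\<in>Ker \<eta>. \<forall>y\<in>Ker \<eta>. g (br \<xi> x) y + g x (br \<xi> y) = 2 * c * g x y)"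
proof -
  \<comment> \<open>The dimension is odd, hence non-zero; this gives the kernel the finite spanning
    set on which the adjoint is known to exist.\<close>
  have "dim (UNIV :: 'a set) \<noteq> 0"
    using acm unfolding almost_contact_metric_lie_algebra_def by simp
  then obtain B where "finite B" "Ker \<eta> = span B"
    using subspace_finite_basis[OF subspace_Ker] by blast
  moreover have "inner_product_on (Ker \<eta>) g"
    using ip unfolding inner_product_on_def bilinear_on_def linear_on_def by simp
  ultimately show ?thesis
    using symmetric_part_on_eq_scaleR_iff ad_xi_endomorphism by blast
qed

lemma alpha_coKaehler_iff:
  "alpha_coKaehler \<alpha> br \<phi> \<xi> \<eta> g \<longleftrightarrow>
     lie_subalgebra (Ker \<eta>) br \<and> abelian_Kaehler_on (Ker \<eta>) br \<phi> g \<and>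
     (\<forall>x\<in>Ker \<eta>. symmetric_part_on (Ker \<eta>) g (br \<xi>) x = - \<alpha> *\<^sub>R x)"
proof -
  have "alpha_coKaehler \<alpha> br \<phi> \<xi> \<eta> g \<longleftrightarrow> lie_subalgebra (Ker \<eta>) br \<and>
    (\<forall>x y z. d_two_form br (fundamental_form g \<phi>) x y z
             = 2 * \<alpha> * wedge_one_two \<eta> (fundamental_form g \<phi>) x y z)"
    unfolding alpha_coKaehler_def d_one_form_def
    using ac normal eta_br_eq_0_iff by simp
  then show ?thesis
    unfolding d_fundamental_form_eq_iff symmetric_part_ad_xi_iff
    using abelian_Kaehler_on_Ker_iff by blast
qed

end

theorem proposition3p14:
  fixes br :: "'a::real_vector \<Rightarrow> 'a \<Rightarrow> 'a"
    and \<phi> :: "'a \<Rightarrow> 'a" and \<xi> :: 'a and \<eta> :: "'a \<Rightarrow> real" and g :: "'a \<Rightarrow> 'a \<Rightarrow> real"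
    and n :: nat and \<alpha> :: real
  assumes "almost_contact_metric_lie_algebra n br \<phi> \<xi> \<eta> g"
    and "abelian_almost_contact br \<phi> \<xi> \<eta>"
  shows "alpha_coKaehler \<alpha> br \<phi> \<xi> \<eta> g \<longleftrightarrow>
           lie_subalgebra (Ker \<eta>) br \<and> abelian_Kaehler_on (Ker \<eta>) br \<phi> g \<and>
           (\<forall>x\<in>Ker \<eta>. symmetric_part_on (Ker \<eta>) g (br \<xi>) x = - \<alpha> *\<^sub>R x)"
proof -
  interpret abelian_contact_metric_lie_algebra br \<phi> \<xi> \<eta> g n
    using assms by unfold_locales
  show ?thesis by (rule alpha_coKaehler_iff)
qed

end
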